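(* For every integer $m\ge 2$, the graph $P_m$ is vertex decomposable, and a vertex $v$ belongs to $\mathrm{Shed}(P_m)$ if and only if $v=z_1$ or $v=z_2$.
   Context: For $m\ge2$, $P_m$ is the graph with vertex set $X\cup Y\cup Z$, $X=\{x_1,\ldots,x_{2m}\}$, $Y=\{y_1,y_2\}$, $Z=\{z_1,z_2,z_3\}$, whose edges are exactly: (i) the induced subgraph on $X$ is the complete $m$-partite graph $K_{2,\ldots,2}$ whose complement is the matching $\{x_{2i-1},x_{2i}\}$, $1\le i\le m$; (ii) $y_1$ is adjacent to $z_1$ and to each $x_{2i-1}$, $1\le i\le m$; (iii) $y_2$ is adjacent to $z_2$ and to each $x_{2i}$, $1\le i\le m$; (iv) $Z$ induces a triangle $K_3$. For a graph $G=(V,E)$ and $x\in V$, $G\setminus x$ is the graph obtained by deleting $x$ and its incident edges; $N[x]$ is $x$ together with its neighbours, and $G\setminus N[x]$ is obtained by deleting all vertices of $N[x]$ and their incident edges. A graph is well-covered if all its maximal independent sets have the same cardinality. A graph $G$ is vertex decomposable if $G$ is well-covered and either (i) $G$ has no edges (possibly no vertices), or (ii) there is a vertex $x$ such that both $G\setminus x$ and $G\setminus N[x]$ are vertex decomposable. For a vertex decomposable graph $G$, $\mathrm{Shed}(G)$ is the set of vertices $x$ such that $G\setminus x$ and $G\setminus N[x]$ are both vertex decomposable. *)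

theory Defs
  imports "Graph_Theory.Graph_Theory"
begin

text \<open>
  Finite simple graphs are the symmetric digraphs of the locale \<open>graph\<close>, an edge being a pair
  of opposite arcs. The notions below are meant for such graphs, a class that is closed under
  deleting vertices.
\<close>

definition closed_nbhd :: "('a, 'b) pre_digraph \<Rightarrow> 'a \<Rightarrow> 'a set" where
  "closed_nbhd G x = insert x {v \<in> verts G. x \<rightarrow>\<^bsub>G\<^esub> v}"

abbreviation del_vertex :: "('a, 'b) pre_digraph \<Rightarrow> 'a \<Rightarrow> ('a, 'b) pre_digraph" where
  "del_vertex G x \<equiv> pre_digraph.del_vert G x"

definition del_closed_nbhd :: "('a, 'b) pre_digraph \<Rightarrow> 'a \<Rightarrow> ('a, 'b) pre_digraph" where
  "del_closed_nbhd G x = G \<restriction> (verts G - closed_nbhd G x)"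

definition independent_set :: "('a, 'b) pre_digraph \<Rightarrow> 'a set \<Rightarrow> bool" where
  "independent_set G S \<longleftrightarrow> S \<subseteq> verts G \<and> (\<forall>u\<in>S. \<forall>v\<in>S. \<not> u \<rightarrow>\<^bsub>G\<^esub> v)"

definition maximal_independent_set :: "('a, 'b) pre_digraph \<Rightarrow> 'a set \<Rightarrow> bool" where
  "maximal_independent_set G S \<longleftrightarrow>
     independent_set G S \<and> (\<forall>T. independent_set G T \<and> S \<subseteq> T \<longrightarrow> T = S)"

definition well_covered :: "('a, 'b) pre_digraph \<Rightarrow> bool" where
  "well_covered G \<longleftrightarrow>
     (\<forall>S T. maximal_independent_set G S \<and> maximal_independent_set G T \<longrightarrow> card S = card T)"

inductive vertex_decomposable :: "('a, 'b) pre_digraph \<Rightarrow> bool" where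
  no_edges: "well_covered G \<Longrightarrow> arcs G = {} \<Longrightarrow> vertex_decomposable G"
| shedding: "well_covered G \<Longrightarrow> x \<in> verts G \<Longrightarrow>
    vertex_decomposable (del_vertex G x) \<Longrightarrow> vertex_decomposable (del_closed_nbhd G x) \<Longrightarrow>
    vertex_decomposable G"

definition Shed :: "('a, 'b) pre_digraph \<Rightarrow> 'a set" where
  "Shed G = {x \<in> verts G. vertex_decomposable (del_vertex G x) \<and>
                          vertex_decomposable (del_closed_nbhd G x)}"

datatype P_vertex = x_vert nat | y_vert nat | z_vert nat

definition P_verts :: "nat \<Rightarrow> P_vertex set" where
  "P_verts m = x_vert ` {1..2 * m} \<union> y_vert ` {1, 2} \<union> z_vert ` {1, 2, 3}"

definition P_edges :: "nat \<Rightarrow> P_vertex rel" where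
  "P_edges m =
     {(x_vert i, x_vert j) | i j. i \<in> {1..2 * m} \<and> j \<in> {1..2 * m} \<and> i \<noteq> j \<and>
        \<not> (\<exists>k\<in>{1..m}. {i, j} = {2 * k - 1, 2 * k})}
     \<union> {(y_vert 1, z_vert 1)} \<union> {(y_vert 1, x_vert (2 * k - 1)) | k. k \<in> {1..m}}
     \<union> {(y_vert 2, z_vert 2)} \<union> {(y_vert 2, x_vert (2 * k)) | k. k \<in> {1..m}}
     \<union> {(z_vert 1, z_vert 2), (z_vert 1, z_vert 3), (z_vert 2, z_vert 3)}"

definition P_graph :: "nat \<Rightarrow> (P_vertex, P_vertex \<times> P_vertex) pre_digraph" where
  "P_graph m = with_proj \<lparr> pverts = P_verts m, parcs = P_edges m \<union> (P_edges m)\<inverse> \<rparr>"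

lemma graph_P_graph: "graph (P_graph m)"
proof -
  have sub: "u \<in> P_verts m \<and> v \<in> P_verts m \<and> u \<noteq> v" if "(u, v) \<in> P_edges m" for u v
    using that unfolding P_edges_def P_verts_def by (elim UnE) (auto intro!: image_eqI)
  have fin: "finite (P_verts m)"
    by (simp add: P_verts_def)
  have "P_edges m \<subseteq> P_verts m \<times> P_verts m"
    using sub by auto
  then have finE: "finite (P_edges m)"
    using fin by (meson finite_SigmaI finite_subset)
  define E where "E = P_edges m \<union> (P_edges m)\<inverse>"
  have E: "finite E" "sym E"
    using finE by (auto simp: E_def sym_def)
  have E': "fst e \<in> P_verts m \<and> snd e \<in> P_verts m \<and> fst e \<noteq> snd e" if "e \<in> E" for e
    using that sub by (cases e) (auto simp: E_def)
  interpret pair_graph "\<lparr> pverts = P_verts m, parcs = E \<rparr>"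
    by unfold_locales (simp_all add: E E' fin symmetric_def)
  have "graph (with_proj \<lparr> pverts = P_verts m, parcs = E \<rparr>)"
    by unfold_locales
  then show ?thesis
    by (simp only: P_graph_def E_def)
qed

end

theory Submission
  imports Defs
begin

text \<open>
  Deleting \<open>z\<^sub>1\<close> and then \<open>z\<^sub>2\<close>, or the closed neighbourhood of either, leaves graphs that are
  dismantled down to a clique plus isolated vertices by removing the vertices of one half of
  \<open>X\<close>. Deleting \<open>z\<^sub>3\<close> or a vertex of \<open>X\<close> destroys well-coveredness. Deleting \<open>y\<^sub>1\<close> does not, but
  then the alternating sum of independent sets by size is \<open>m - 1 > 0\<close>, while for a vertex
  decomposable graph whose maximal independent sets have \<open>r\<close> elements (here \<open>r = 3\<close>) this sum
  has sign \<open>(-1)\<^sup>r\<close> or vanishes. The vertex \<open>y\<^sub>2\<close> is symmetric to \<open>y\<^sub>1\<close>.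
\<close>

section \<open>Independent sets under vertex deletion\<close>

lemma adj_induce_subgraph: "u \<rightarrow>\<^bsub>G \<restriction> W\<^esub> v \<longleftrightarrow> u \<in> W \<and> v \<in> W \<and> u \<rightarrow>\<^bsub>G\<^esub> v"
  by (auto simp: arcs_ends_conv)

lemma graph_induce_subgraph:
  assumes "graph G" "finite W"
  shows "graph (G \<restriction> W)"
proof -
  interpret graph G by fact
  have "u \<rightarrow>\<^bsub>G \<restriction> W\<^esub> v \<Longrightarrow> v \<rightarrow>\<^bsub>G \<restriction> W\<^esub> u" for u v
    using graph_symmetric by (auto simp: adj_induce_subgraph)
  then have "symmetric (G \<restriction> W)"
    by (auto simp: symmetric_def sym_def)
  then show ?thesis
    using \<open>finite W\<close> no_loops no_multi_arcs by unfold_locales auto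
qed

lemma del_vertex_conv_induce: "wf_digraph G \<Longrightarrow> del_vertex G x = G \<restriction> (verts G - {x})"
  by (auto simp: pre_digraph.del_vert_def induce_subgraph_def wf_digraph.wellformed)

lemma induce_subgraph_self: "wf_digraph G \<Longrightarrow> G \<restriction> verts G = G"
  by (intro pre_digraph.equality) (auto simp: wf_digraph.wellformed)

lemma induce_induce_subgraph: "V \<subseteq> W \<Longrightarrow> (G \<restriction> W) \<restriction> V = G \<restriction> V"
  by (auto simp: induce_subgraph_def)

lemma del_vertex_induce: "del_vertex (G \<restriction> W) x = G \<restriction> (W - {x})"
  by (auto simp: pre_digraph.del_vert_def induce_subgraph_def)

text \<open>Together with \<open>del_vertex_induce\<close>, this keeps iterated deletions inside one
  fixed \<open>G\<close>: only the vertex set has to be recomputed.\<close>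

lemma del_closed_nbhd_induce:
  "x \<in> W \<Longrightarrow> del_closed_nbhd (G \<restriction> W) x = G \<restriction> (W - insert x {v. x \<rightarrow>\<^bsub>G\<^esub> v})"
  unfolding del_closed_nbhd_def closed_nbhd_def
  by (subst induce_induce_subgraph) (auto simp: adj_induce_subgraph intro!: arg_cong2[where f = induce_subgraph])

lemma independent_set_induce:
  "independent_set (G \<restriction> W) S \<longleftrightarrow> S \<subseteq> W \<and> (\<forall>u\<in>S. \<forall>v\<in>S. \<not> u \<rightarrow>\<^bsub>G\<^esub> v)"
  by (auto simp: independent_set_def adj_induce_subgraph)

lemma independent_set_subset: "independent_set G T \<Longrightarrow> S \<subseteq> T \<Longrightarrow> independent_set G S"
  by (auto simp: independent_set_def)

lemma independent_set_del_vertex: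
  assumes "wf_digraph G"
  shows "independent_set (del_vertex G x) S \<longleftrightarrow> x \<notin> S \<and> independent_set G S"
  unfolding del_vertex_conv_induce[OF assms] independent_set_induce
  by (auto simp: independent_set_def)

text \<open>A set that survives the deletion meets no neighbour of \<open>x\<close>, so
  \<open>x\<close> can be added back. These sets form the link of \<open>x\<close> in the
  independence complex.\<close>

lemma independent_set_del_closed_nbhd:
  assumes "graph G" "x \<in> verts G"
  shows "independent_set (del_closed_nbhd G x) S \<longleftrightarrow> x \<notin> S \<and> independent_set G (insert x S)"
proof -
  interpret graph G by fact
  show ?thesis
    using assms(2) adj_not_same graph_symmetric
    unfolding independent_set_induce del_closed_nbhd_def
    by (fastforce simp: independent_set_def closed_nbhd_def)
qed

lemma maximal_independent_setI:
  assumes "independent_set G S" "\<And>v. v \<in> verts G \<Longrightarrow> v \<notin> S \<Longrightarrow> \<exists>u\<in>S. u \<rightarrow>\<^bsub>G\<^esub> v"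
  shows "maximal_independent_set G S"
  using assms unfolding maximal_independent_set_def independent_set_def by blast

text \<open>Only this direction holds in general: a set that is maximal after the deletion may still
  be extendable by \<open>x\<close>.\<close>

lemma maximal_independent_set_del_vertex:
  assumes "wf_digraph G" "maximal_independent_set G S" "x \<notin> S"
  shows "maximal_independent_set (del_vertex G x) S"
  using assms unfolding maximal_independent_set_def by (simp add: independent_set_del_vertex)

lemma maximal_independent_set_del_closed_nbhd:
  assumes "graph G" "x \<in> verts G" "x \<notin> S"
  shows "maximal_independent_set (del_closed_nbhd G x) S \<longleftrightarrow> maximal_independent_set G (insert x S)"
proof
  assume S: "maximal_independent_set (del_closed_nbhd G x) S"
  show "maximal_independent_set G (insert x S)"
    unfolding maximal_independent_set_def
  proof (intro conjI allI impI)
    show "independent_set G (insert x S)"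
      using S assms by (auto simp: maximal_independent_set_def independent_set_del_closed_nbhd)
    fix T assume T: "independent_set G T \<and> insert x S \<subseteq> T"
    then have "insert x (T - {x}) = T"
      by auto
    then have "independent_set (del_closed_nbhd G x) (T - {x})"
      using T assms by (auto simp: independent_set_del_closed_nbhd)
    then have "T - {x} = S"
      using S T assms unfolding maximal_independent_set_def by blast
    then show "T = insert x S"
      using T by auto
  qed
next
  assume S: "maximal_independent_set G (insert x S)"
  show "maximal_independent_set (del_closed_nbhd G x) S"
    unfolding maximal_independent_set_def independent_set_del_closed_nbhd[OF assms(1,2)]
  proof (intro conjI allI impI)
    fix T assume T: "(x \<notin> T \<and> independent_set G (insert x T)) \<and> S \<subseteq> T"
    then have "insert x T = insert x S"
      using S unfolding maximal_independent_set_def by blast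
    then show "T = S"
      using T assms(3) by (metis insert_ident)
  qed (use S assms(3) in \<open>auto simp: maximal_independent_set_def\<close>)
qed

lemma (in fin_digraph) independent_set_finite: "independent_set G S \<Longrightarrow> finite S"
  by (auto simp: independent_set_def intro: finite_subset)

lemma (in fin_digraph) independent_set_extend:
  assumes "independent_set G S"
  obtains T where "maximal_independent_set G T" "S \<subseteq> T"
proof -
  have "finite {T. independent_set G T}"
    by (rule finite_subset[of _ "Pow (verts G)"]) (auto simp: independent_set_def)
  then obtain T where "S \<subseteq> T" "independent_set G T"
    "\<forall>U. independent_set G U \<longrightarrow> T \<subseteq> U \<longrightarrow> T = U"
    using finite_has_maximal2[of "{T. independent_set G T}" S] assms by auto
  then show thesis
    using that unfolding maximal_independent_set_def by blast
qed

section \<open>Rank recursion for vertex decomposable graphs\<close>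

lemma vertex_decomposable_well_covered: "vertex_decomposable G \<Longrightarrow> well_covered G"
  by (induction rule: vertex_decomposable.induct) auto

text \<open>Well-coveredness of the two smaller graphs does not give that of the whole graph.
  Carrying the common size \<open>r\<close> makes the two cases comparable.\<close>

definition vd_rank :: "('a, 'b) pre_digraph \<Rightarrow> nat \<Rightarrow> bool" where
  "vd_rank G r \<longleftrightarrow> vertex_decomposable G \<and> (\<forall>S. maximal_independent_set G S \<longrightarrow> card S = r)"

text \<open>Maximal sets avoiding \<open>x\<close> stay maximal in \<open>del_vertex G x\<close>;
  those containing \<open>x\<close> lose it and become maximal in
  \<open>del_closed_nbhd G x\<close>. Either way the size is \<open>Suc r\<close>, which yields the
  well-coveredness that \<open>shedding\<close> demands.\<close>

lemma vd_rank_shedding: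
  assumes "graph G" "x \<in> verts G"
    and "vd_rank (del_vertex G x) (Suc r)" "vd_rank (del_closed_nbhd G x) r"
  shows "vd_rank G (Suc r)"
proof -
  interpret graph G by fact
  have card: "card S = Suc r" if S: "maximal_independent_set G S" for S
  proof (cases "x \<in> S")
    case True
    then have "insert x (S - {x}) = S" by auto
    then have "card (S - {x}) = r"
      using maximal_independent_set_del_closed_nbhd[of G x "S - {x}"] assms S
      by (auto simp: vd_rank_def)
    then show ?thesis
      using S True independent_set_finite
      by (metis maximal_independent_set_def card_Suc_Diff1)
  next
    case False
    then show ?thesis
      using maximal_independent_set_del_vertex[OF wf_digraph_axioms S] assms by (auto simp: vd_rank_def)
  qed
  then have "well_covered G"
    by (auto simp: well_covered_def)
  then show ?thesis
    using assms card by (auto simp: vd_rank_def intro: shedding)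
qed

lemma vd_rank_edgeless:
  assumes "\<And>u v. u \<in> W \<Longrightarrow> v \<in> W \<Longrightarrow> \<not> u \<rightarrow>\<^bsub>G\<^esub> v"
  shows "vd_rank (G \<restriction> W) (card W)"
proof -
  have *: "S = W" if "maximal_independent_set (G \<restriction> W) S" for S
    using that assms unfolding maximal_independent_set_def independent_set_induce by blast
  moreover have "arcs (G \<restriction> W) = {}"
    using assms by (auto simp: arcs_ends_conv)
  moreover have "well_covered (G \<restriction> W)"
    unfolding well_covered_def using * by blast
  ultimately show ?thesis
    using no_edges by (auto simp only: vd_rank_def)
qed

lemma vd_rank_induce_shedding:
  assumes "graph G" "finite W" "x \<in> W"
    and "vd_rank (G \<restriction> (W - {x})) (Suc r)"
    and "vd_rank (G \<restriction> (W - insert x {v. x \<rightarrow>\<^bsub>G\<^esub> v})) r"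
  shows "vd_rank (G \<restriction> W) (Suc r)"
  using assms vd_rank_shedding[of "G \<restriction> W" x r]
  by (simp add: graph_induce_subgraph del_vertex_induce del_closed_nbhd_induce)

text \<open>Clique vertices are shed one at a time: deletion leaves a smaller clique, and deleting
  the closed neighbourhood leaves the edgeless \<open>I\<close>. The last clique vertex is itself
  isolated, so the process ends in an edgeless graph.\<close>

lemma vd_rank_clique_isolated:
  assumes "graph G" "finite K" "K \<noteq> {}" "K \<inter> I = {}"
    and "\<And>u v. u \<in> K \<Longrightarrow> v \<in> K \<Longrightarrow> u \<noteq> v \<Longrightarrow> u \<rightarrow>\<^bsub>G\<^esub> v"
    and "\<And>u v. u \<in> I \<Longrightarrow> v \<in> K \<union> I \<Longrightarrow> \<not> u \<rightarrow>\<^bsub>G\<^esub> v"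
    and "finite I"
  shows "vd_rank (G \<restriction> (K \<union> I)) (Suc (card I))"
  using assms(2-6)
proof (induction K rule: finite_ne_induct)
  case (singleton k)
  interpret graph G by fact
  have "\<not> u \<rightarrow>\<^bsub>G\<^esub> v" if "u \<in> insert k I" "v \<in> insert k I" for u v
    using that singleton.prems(3)[of u v] singleton.prems(3)[of v u] adj_not_same[of u]
      graph_symmetric[of u v] by auto
  then have "vd_rank (G \<restriction> insert k I) (card (insert k I))"
    by (rule vd_rank_edgeless)
  then show ?case
    using singleton \<open>finite I\<close> by simp
next
  case (insert k K)
  interpret graph G by fact
  have 1: "insert k K \<union> I - {k} = K \<union> I"
    using insert by auto
  have nadj: "\<not> k \<rightarrow>\<^bsub>G\<^esub> v" if "v \<in> I" for v
    using that insert.prems(3)[of v k] graph_symmetric by blast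
  have 2: "insert k K \<union> I - insert k {v. k \<rightarrow>\<^bsub>G\<^esub> v} = I"
    using insert.prems(1,2) insert.hyps nadj by auto
  show ?case
  proof (rule vd_rank_induce_shedding[OF \<open>graph G\<close>, of _ k], unfold 1 2)
    show "vd_rank (G \<restriction> (K \<union> I)) (Suc (card I))"
      by (rule insert.IH) (use insert.prems in auto)
    show "vd_rank (G \<restriction> I) (card I)"
      by (rule vd_rank_edgeless) (use insert.prems in auto)
  qed (use insert.hyps \<open>finite I\<close> in auto)
qed

section \<open>The alternating sum of independent sets\<close>

text \<open>This is the independence polynomial evaluated at -1; the empty set contributes
  1.\<close>

definition alt_indep_sum :: "('a, 'b) pre_digraph \<Rightarrow> int" where
  "alt_indep_sum G = (\<Sum>S | independent_set G S. (-1) ^ card S)"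

text \<open>Independent sets are split by whether they contain \<open>x\<close>. Those that do are
  sets of the link with \<open>x\<close> added, which flips the sign.\<close>

lemma alt_indep_sum_rec:
  assumes "graph G" "x \<in> verts G"
  shows "alt_indep_sum G = alt_indep_sum (del_vertex G x) - alt_indep_sum (del_closed_nbhd G x)"
proof -
  interpret graph G by fact
  let ?D = "{S. independent_set (del_vertex G x) S}"
  let ?L = "{S. independent_set (del_closed_nbhd G x) S}"
  have fin: "finite {S. independent_set G S}"
    by (rule finite_subset[of _ "Pow (verts G)"]) (auto simp: independent_set_def)
  have D: "?D = {S. x \<notin> S \<and> independent_set G S}"
    by (simp add: independent_set_del_vertex[OF wf_digraph_axioms])
  have L: "?L = {S. x \<notin> S \<and> independent_set G (insert x S)}"
    using assms by (simp add: independent_set_del_closed_nbhd)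
  have LD: "?L \<subseteq> ?D"
    unfolding L D using independent_set_subset by blast
  have "{S. independent_set G S} = ?D \<union> insert x ` ?L"
  proof -
    have "S \<in> insert x ` ?L" if "independent_set G S" "x \<in> S" for S
      using that by (intro image_eqI[of _ _ "S - {x}"]) (auto simp: L insert_absorb)
    then show ?thesis
      by (auto simp: L D)
  qed
  moreover have "?D \<inter> insert x ` ?L = {}"
    by (auto simp: D)
  moreover have finD: "finite ?D"
    using fin by (simp add: D)
  ultimately have "alt_indep_sum G =
      alt_indep_sum (del_vertex G x) + (\<Sum>S\<in>insert x ` ?L. (-1) ^ card S)"
    using finite_subset[OF LD finD]
    by (simp add: alt_indep_sum_def sum.union_disjoint)
  also have "(\<Sum>S\<in>insert x ` ?L. (-1) ^ card S) = (\<Sum>S\<in>?L. (-1) ^ card (insert x S) :: int)"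
    by (subst sum.reindex) (auto simp: L inj_on_def)
  also have "\<dots> = (\<Sum>S\<in>?L. - ((-1) ^ card S))"
  proof (rule sum.cong)
    fix S assume "S \<in> ?L"
    then have "finite S" "x \<notin> S"
      using LD independent_set_finite by (auto simp: L D)
    then show "(-1) ^ card (insert x S) = - ((-1) ^ card S :: int)"
      by simp
  qed simp
  finally show ?thesis
    by (simp add: alt_indep_sum_def sum_negf)
qed

text \<open>For an isolated vertex the two deletions coincide, so the two terms of the recursion
  cancel.\<close>

lemma alt_indep_sum_isolated:
  assumes "graph G" "x \<in> verts G" "\<And>v. v \<in> verts G \<Longrightarrow> \<not> x \<rightarrow>\<^bsub>G\<^esub> v"
  shows "alt_indep_sum G = 0"
proof -
  interpret graph G by fact
  have "closed_nbhd G x = {x}"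
    using assms by (auto simp: closed_nbhd_def)
  then have "del_closed_nbhd G x = del_vertex G x"
    by (simp add: del_closed_nbhd_def del_vertex_conv_induce[OF wf_digraph_axioms])
  then show ?thesis
    using alt_indep_sum_rec[OF assms(1,2)] by simp
qed

text \<open>Up to sign, \<open>alt_indep_sum G\<close> is the reduced Euler characteristic of the independence complex,
  which for a vertex decomposable graph is a wedge of spheres of top dimension.\<close>

lemma vertex_decomposable_alt_indep_sum:
  assumes "vertex_decomposable G" "graph G" "maximal_independent_set G S"
  shows "(-1) ^ card S * alt_indep_sum G \<ge> 0"
  using assms
proof (induction arbitrary: S rule: vertex_decomposable.induct)
  case (no_edges G)
  interpret graph G by fact
  have noadj: "\<not> u \<rightarrow>\<^bsub>G\<^esub> v" for u v
    using no_edges by (simp add: arcs_ends_conv)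
  show ?case
  proof (cases "verts G = {}")
    case True
    then have "{S. independent_set G S} = {{}}" "S = {}"
      using no_edges.prems by (auto simp: independent_set_def maximal_independent_set_def)
    then show ?thesis
      by (simp add: alt_indep_sum_def)
  next
    \<comment> \<open>In an edgeless graph every vertex is isolated, so the sum vanishes as soon as
      there is one.\<close>
    case False
    then show ?thesis
      using alt_indep_sum_isolated[OF \<open>graph G\<close>] noadj by fastforce
  qed
next
  case (shedding G x)
  interpret graph G by fact
  \<comment> \<open>An isolated \<open>x\<close> lies in every maximal independent set, so its
    deletion lowers their size and the signs below would not match. The sum is then zero
    anyway.\<close>
  show ?case
  proof (cases "\<exists>y\<in>verts G. x \<rightarrow>\<^bsub>G\<^esub> y")
    case False
    then show ?thesis
      using alt_indep_sum_isolated[OF \<open>graph G\<close> \<open>x \<in> verts G\<close>] by auto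
  next
    case True
    then obtain y where y: "y \<in> verts G" "x \<rightarrow>\<^bsub>G\<^esub> y" by blast
    have graphs: "graph (del_vertex G x)" "graph (del_closed_nbhd G x)"
      using graph_induce_subgraph[OF \<open>graph G\<close>]
      by (simp_all add: del_vertex_conv_induce[OF wf_digraph_axioms] del_closed_nbhd_def)
    \<comment> \<open>The neighbour \<open>y\<close> forces a maximal set \<open>T\<close> to avoid
      \<open>x\<close>. \<open>T\<close> and \<open>U - {x}\<close> are the maximal sets to which
      the two induction hypotheses apply.\<close>
    have "independent_set G {y}" "independent_set G {x}"
      using y shedding.hyps adj_not_same by (auto simp: independent_set_def)
    then obtain T U where T: "maximal_independent_set G T" "y \<in> T"
      and U: "maximal_independent_set G U" "x \<in> U"
      by (metis independent_set_extend insert_subset)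
    have "x \<notin> T"
      using T y by (auto simp: maximal_independent_set_def independent_set_def)
    then have "maximal_independent_set (del_vertex G x) T"
      using T by (simp add: maximal_independent_set_del_vertex[OF wf_digraph_axioms])
    then have "(-1) ^ card T * alt_indep_sum (del_vertex G x) \<ge> 0"
      using shedding.IH(1) graphs by blast
    moreover have "insert x (U - {x}) = U"
      using U by auto
    then have "maximal_independent_set (del_closed_nbhd G x) (U - {x})"
      using U shedding.hyps
        maximal_independent_set_del_closed_nbhd[OF \<open>graph G\<close> \<open>x \<in> verts G\<close>, of "U - {x}"] by simp
    then have "(-1) ^ card (U - {x}) * alt_indep_sum (del_closed_nbhd G x) \<ge> 0"
      using shedding.IH(2) graphs by blast
    moreover have "card T = card S" "card U = card S"
      using T U shedding unfolding well_covered_def by blast+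
    moreover have "Suc (card (U - {x})) = card U"
      using U independent_set_finite by (metis maximal_independent_set_def card_Suc_Diff1)
    ultimately have "card S = Suc (card (U - {x}))" "card T = card S"
      "(-1) ^ card T * alt_indep_sum (del_vertex G x) \<ge> 0"
      "(-1) ^ card (U - {x}) * alt_indep_sum (del_closed_nbhd G x) \<ge> 0"
      by simp_all
    \<comment> \<open>The drop by one in cardinality absorbs the minus sign of the recursion,
      leaving a sum of two nonnegative terms.\<close>
    then show ?thesis
      using alt_indep_sum_rec[OF \<open>graph G\<close> \<open>x \<in> verts G\<close>] by (simp add: right_diff_distrib)
  qed
qed

lemma alt_indep_sum_induce_rec:
  assumes "graph G" "finite W" "x \<in> W"
  shows "alt_indep_sum (G \<restriction> W) =
    alt_indep_sum (G \<restriction> (W - {x})) - alt_indep_sum (G \<restriction> (W - insert x {v. x \<rightarrow>\<^bsub>G\<^esub> v}))"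
  using assms alt_indep_sum_rec[of "G \<restriction> W" x]
  by (simp add: graph_induce_subgraph del_vertex_induce del_closed_nbhd_induce)

lemma alt_indep_sum_induce_isolated:
  assumes "graph G" "finite W" "x \<in> W" "\<And>v. v \<in> W \<Longrightarrow> \<not> x \<rightarrow>\<^bsub>G\<^esub> v"
  shows "alt_indep_sum (G \<restriction> W) = 0"
  using assms alt_indep_sum_isolated[of "G \<restriction> W" x]
  by (simp add: graph_induce_subgraph adj_induce_subgraph)

lemma alt_indep_sum_empty: "alt_indep_sum (G \<restriction> {}) = 1"
proof -
  have "{S. independent_set (G \<restriction> {}) S} = {{}}"
    by (auto simp: independent_set_induce)
  then show ?thesis
    by (simp add: alt_indep_sum_def)
qed

text \<open>Only the empty set and the singletons are independent. In the recursion each vertex has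
  an empty link and hence subtracts 1.\<close>

lemma alt_indep_sum_clique:
  assumes "graph G" "finite K" "\<And>u v. u \<in> K \<Longrightarrow> v \<in> K \<Longrightarrow> u \<noteq> v \<Longrightarrow> u \<rightarrow>\<^bsub>G\<^esub> v"
  shows "alt_indep_sum (G \<restriction> K) = 1 - int (card K)"
  using assms(2,3)
proof (induction K rule: finite_induct)
  case empty
  show ?case
    by (simp add: alt_indep_sum_empty)
next
  case (insert k K)
  interpret graph G by fact
  have 1: "insert k K - {k} = K"
    using insert by auto
  have 2: "insert k K - insert k {v. k \<rightarrow>\<^bsub>G\<^esub> v} = {}"
    using insert.hyps insert.prems by blast
  show ?case
    using alt_indep_sum_induce_rec[OF \<open>graph G\<close>, of "insert k K" k] insert
    unfolding 1 2 by (simp add: alt_indep_sum_empty)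
qed

section \<open>The graphs \<open>P\<^sub>m\<close>\<close>

lemma adj_P_graph: "u \<rightarrow>\<^bsub>P_graph m\<^esub> v \<longleftrightarrow> (u, v) \<in> P_edges m \<or> (v, u) \<in> P_edges m"
  by (simp add: P_graph_def)

text \<open>The halves of \<open>P\<^sub>m\<close> play symmetric roles, so everything is done for
  \<open>{s, t} = {1, 2}\<close>. With indices shifted to \<open>i < m\<close>, the partners \<open>a i\<close> and \<open>b i\<close> are the
  non-adjacent pairs in \<open>X\<close>.\<close>

definition xv :: "nat \<Rightarrow> nat \<Rightarrow> P_vertex" where
  "xv p i = x_vert (2 * i + p)"

lemma xv_simps [simp]:
  "xv p i = xv p j \<longleftrightarrow> i = j" "xv p i \<noteq> y_vert k" "xv p i \<noteq> z_vert k"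
  "y_vert k \<noteq> xv p i" "z_vert k \<noteq> xv p i"
  by (auto simp: xv_def)

locale P_sides =
  fixes m s t :: nat
  assumes m: "m \<ge> 2" and st: "s = 1 \<and> t = 2 \<or> s = 2 \<and> t = 1"
begin

abbreviation "G \<equiv> P_graph m"
abbreviation "a \<equiv> xv s"
abbreviation "b \<equiv> xv t"
abbreviation "ys \<equiv> y_vert s"
abbreviation "yt \<equiv> y_vert t"
abbreviation "zs \<equiv> z_vert s"
abbreviation "zt \<equiv> z_vert t"
abbreviation "z3 \<equiv> z_vert 3"

sublocale graph G
  by (rule graph_P_graph)

lemma swap: "P_sides m t s"
  using m st by unfold_locales auto

lemma distinct_sides [simp]:
  "s \<noteq> t" "t \<noteq> s" "s \<noteq> 3" "t \<noteq> 3" "3 \<noteq> s" "3 \<noteq> t" "a i \<noteq> b j" "b i \<noteq> a j"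
  using st by (auto simp: xv_def; presburger)+

section \<open>Vertices and adjacency of \<open>G\<close> in terms of the two sides\<close>

lemma verts_G: "verts G = a ` {..<m} \<union> b ` {..<m} \<union> {ys, yt, zs, zt, z3}"
proof -
  have "k \<in> (\<lambda>i. 2 * i + 1) ` {..<m} \<union> (\<lambda>i. 2 * i + 2) ` {..<m}" if "k \<in> {1..2 * m}" for k
  proof (cases "even k")
    case True
    then obtain l where "k = 2 * l" ..
    then show ?thesis using that by (intro UnI2 image_eqI[of _ _ "l - 1"]) auto
  next
    case False
    then obtain l where "k = 2 * l + 1" ..
    then show ?thesis using that by auto
  qed
  then have "{1..2 * m} \<subseteq> (\<lambda>i. 2 * i + 1) ` {..<m} \<union> (\<lambda>i. 2 * i + 2) ` {..<m}"
    by blast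
  moreover have "(\<lambda>i. 2 * i + 1) ` {..<m} \<union> (\<lambda>i. 2 * i + 2) ` {..<m} \<subseteq> {1..2 * m}"
    by auto
  ultimately have "{1..2 * m} = (\<lambda>i. 2 * i + 1) ` {..<m} \<union> (\<lambda>i. 2 * i + 2) ` {..<m}"
    by (rule subset_antisym)
  then have "{1..2 * m} = (\<lambda>i. 2 * i + s) ` {..<m} \<union> (\<lambda>i. 2 * i + t) ` {..<m}"
    using st by auto
  then have "x_vert ` {1..2 * m} = a ` {..<m} \<union> b ` {..<m}"
    by (simp add: image_Un image_image xv_def)
  then show ?thesis
    using st by (auto simp: P_graph_def P_verts_def)
qed

lemma z_in_verts_G [simp]: "zs \<in> verts G" "zt \<in> verts G" "finite (verts G)"
  by (auto simp: verts_G)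

text \<open>The matched pair \<open>{2 * k - 1, 2 * k}\<close> becomes the two vertices with shifted
  index \<open>k - 1\<close>. Being distinct and not matched thus collapses to
  \<open>i \<noteq> j\<close>, whatever the sides.\<close>

lemma adj_xv:
  assumes "p \<in> {1, 2}" "q \<in> {1, 2}" "i < m" "j < m"
  shows "xv p i \<rightarrow>\<^bsub>G\<^esub> xv q j \<longleftrightarrow> i \<noteq> j"
proof -
  have "(\<exists>k\<in>{1..m}. {2 * i + p, 2 * j + q} = {2 * k - 1, 2 * k}) \<longleftrightarrow> i = j \<and> p \<noteq> q"
  proof
    assume "\<exists>k\<in>{1..m}. {2 * i + p, 2 * j + q} = {2 * k - 1, 2 * k}"
    then show "i = j \<and> p \<noteq> q"
      using assms by (auto simp: doubleton_eq_iff; presburger)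
  next
    assume "i = j \<and> p \<noteq> q"
    then show "\<exists>k\<in>{1..m}. {2 * i + p, 2 * j + q} = {2 * k - 1, 2 * k}"
      using assms by (intro bexI[of _ "Suc i"]) (auto simp: doubleton_eq_iff)
  qed
  moreover have "{2 * i + p, 2 * j + q} = {2 * j + q, 2 * i + p}"
    by auto
  moreover have "2 * i + p \<in> {1..2 * m}" "2 * j + q \<in> {1..2 * m}"
    using assms by auto
  moreover have "2 * i + p \<noteq> 2 * j + q \<longleftrightarrow> i \<noteq> j \<or> p \<noteq> q"
    using assms by (auto; presburger)
  ultimately show ?thesis
    unfolding adj_P_graph P_edges_def xv_def by auto
qed

lemma adj_y_xv:
  assumes "p \<in> {1, 2}" "q \<in> {1, 2}" "i < m"
  shows "y_vert p \<rightarrow>\<^bsub>G\<^esub> xv q i \<longleftrightarrow> p = q"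
proof -
  have "(\<exists>k\<in>{1..m}. 2 * i + q = 2 * k - 1) \<longleftrightarrow> q = 1"
  proof
    assume "q = 1"
    then show "\<exists>k\<in>{1..m}. 2 * i + q = 2 * k - 1"
      using assms by (intro bexI[of _ "Suc i"]) auto
  qed (use assms in \<open>auto; presburger\<close>)
  moreover have "(\<exists>k\<in>{1..m}. 2 * i + q = 2 * k) \<longleftrightarrow> q = 2"
  proof
    assume "q = 2"
    then show "\<exists>k\<in>{1..m}. 2 * i + q = 2 * k"
      using assms by (intro bexI[of _ "Suc i"]) auto
  qed (use assms in \<open>auto; presburger\<close>)
  moreover have "(y_vert p, x_vert n) \<in> P_edges m \<longleftrightarrow>
      p = 1 \<and> (\<exists>k\<in>{1..m}. n = 2 * k - 1) \<or> p = 2 \<and> (\<exists>k\<in>{1..m}. n = 2 * k)"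
    "(x_vert n, y_vert p) \<notin> P_edges m" for n
    by (auto simp: P_edges_def)
  ultimately have "y_vert p \<rightarrow>\<^bsub>G\<^esub> xv q i \<longleftrightarrow> p = 1 \<and> q = 1 \<or> p = 2 \<and> q = 2"
    by (simp only: adj_P_graph xv_def) simp
  then show ?thesis
    using assms(1,2) by auto
qed

lemma adj_X [simp]:
  assumes "i < m"
  shows "j < m \<Longrightarrow> a i \<rightarrow>\<^bsub>G\<^esub> a j \<longleftrightarrow> i \<noteq> j" "j < m \<Longrightarrow> a i \<rightarrow>\<^bsub>G\<^esub> b j \<longleftrightarrow> i \<noteq> j"
    "j < m \<Longrightarrow> b i \<rightarrow>\<^bsub>G\<^esub> a j \<longleftrightarrow> i \<noteq> j" "j < m \<Longrightarrow> b i \<rightarrow>\<^bsub>G\<^esub> b j \<longleftrightarrow> i \<noteq> j"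
    "ys \<rightarrow>\<^bsub>G\<^esub> a i" "\<not> ys \<rightarrow>\<^bsub>G\<^esub> b i" "\<not> yt \<rightarrow>\<^bsub>G\<^esub> a i" "yt \<rightarrow>\<^bsub>G\<^esub> b i"
    "a i \<rightarrow>\<^bsub>G\<^esub> ys" "\<not> b i \<rightarrow>\<^bsub>G\<^esub> ys" "\<not> a i \<rightarrow>\<^bsub>G\<^esub> yt" "b i \<rightarrow>\<^bsub>G\<^esub> yt"
proof -
  have half: "s \<in> {1, 2}" "t \<in> {1, 2}"
    using st by auto
  note y = adj_y_xv[OF half(1) half(1) assms] adj_y_xv[OF half(1) half(2) assms]
    adj_y_xv[OF half(2) half(1) assms] adj_y_xv[OF half(2) half(2) assms]
  show "j < m \<Longrightarrow> a i \<rightarrow>\<^bsub>G\<^esub> a j \<longleftrightarrow> i \<noteq> j" "j < m \<Longrightarrow> a i \<rightarrow>\<^bsub>G\<^esub> b j \<longleftrightarrow> i \<noteq> j"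
    "j < m \<Longrightarrow> b i \<rightarrow>\<^bsub>G\<^esub> a j \<longleftrightarrow> i \<noteq> j" "j < m \<Longrightarrow> b i \<rightarrow>\<^bsub>G\<^esub> b j \<longleftrightarrow> i \<noteq> j"
    using half assms by (simp_all only: adj_xv)
  show "ys \<rightarrow>\<^bsub>G\<^esub> a i" "\<not> ys \<rightarrow>\<^bsub>G\<^esub> b i" "\<not> yt \<rightarrow>\<^bsub>G\<^esub> a i" "yt \<rightarrow>\<^bsub>G\<^esub> b i"
    using y by simp_all
  then show "a i \<rightarrow>\<^bsub>G\<^esub> ys" "\<not> b i \<rightarrow>\<^bsub>G\<^esub> ys" "\<not> a i \<rightarrow>\<^bsub>G\<^esub> yt" "b i \<rightarrow>\<^bsub>G\<^esub> yt"
    using graph_symmetric by blast+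
qed

lemma adj_YZ [simp]:
  "\<not> y_vert k \<rightarrow>\<^bsub>G\<^esub> y_vert l"
  "\<not> xv p i \<rightarrow>\<^bsub>G\<^esub> z_vert l" "\<not> z_vert l \<rightarrow>\<^bsub>G\<^esub> xv p i"
  "ys \<rightarrow>\<^bsub>G\<^esub> z_vert k \<longleftrightarrow> k = s" "yt \<rightarrow>\<^bsub>G\<^esub> z_vert k \<longleftrightarrow> k = t"
  "z_vert k \<rightarrow>\<^bsub>G\<^esub> ys \<longleftrightarrow> k = s" "z_vert k \<rightarrow>\<^bsub>G\<^esub> yt \<longleftrightarrow> k = t"
  "\<not> z_vert k \<rightarrow>\<^bsub>G\<^esub> z_vert k"
  "zs \<rightarrow>\<^bsub>G\<^esub> zt" "zt \<rightarrow>\<^bsub>G\<^esub> zs" "zs \<rightarrow>\<^bsub>G\<^esub> z3" "z3 \<rightarrow>\<^bsub>G\<^esub> zs" "zt \<rightarrow>\<^bsub>G\<^esub> z3" "z3 \<rightarrow>\<^bsub>G\<^esub> zt"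
  using st by (auto simp: adj_P_graph P_edges_def xv_def)

section \<open>Shedding orders for \<open>G\<close>\<close>

text \<open>For \<open>J = {..<m}\<close> this is what the closed neighbourhood of \<open>zs\<close>
  leaves. Each \<open>b j\<close> can be shed because its closed neighbourhood covers everything but
  \<open>a j\<close>; at the end \<open>yt\<close> is isolated beside the clique of all
  \<open>a i\<close>.\<close>

lemma vd_rank_spider:
  assumes "J \<subseteq> {..<m}"
  shows "vd_rank (G \<restriction> (a ` {..<m} \<union> {yt} \<union> b ` J)) 2"
  using finite_subset[OF assms finite_lessThan] assms
proof (induction J rule: finite_induct)
  case empty
  have "vd_rank (G \<restriction> (a ` {..<m} \<union> {yt})) (Suc (card {yt}))"
    by (rule vd_rank_clique_isolated) (use m in \<open>auto simp: lessThan_empty_iff intro: graph_P_graph\<close>)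
  then show ?case
    by (simp add: numeral_2_eq_2)
next
  case (insert j J)
  have 1: "a ` {..<m} \<union> {yt} \<union> b ` insert j J - {b j} = a ` {..<m} \<union> {yt} \<union> b ` J"
    using insert by auto
  have 2: "a ` {..<m} \<union> {yt} \<union> b ` insert j J - insert (b j) {v. b j \<rightarrow>\<^bsub>G\<^esub> v} = {a j}"
    using insert by auto
  have "vd_rank (G \<restriction> {a j}) (card {a j})"
    by (rule vd_rank_edgeless) (use insert in auto)
  then show ?case
    using insert vd_rank_induce_shedding[OF graph_P_graph, of "a ` {..<m} \<union> {yt} \<union> b ` insert j J" "b j" m 1]
    unfolding 1 2 by (simp add: numeral_2_eq_2)
qed

text \<open>For \<open>J = {..<m}\<close> this is \<open>G\<close> without \<open>zs\<close> and
  \<open>zt\<close>. The vertices \<open>a j\<close> are shed until \<open>yt\<close> and all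
  \<open>b i\<close> form a clique with \<open>ys\<close> and \<open>z3\<close> isolated. Removing
  the closed neighbourhood of \<open>a j\<close> leaves the edge \<open>{b j, yt}\<close> and the
  isolated \<open>z3\<close>.\<close>

lemma vd_rank_no_zs_zt:
  assumes "J \<subseteq> {..<m}"
  shows "vd_rank (G \<restriction> (a ` J \<union> (b ` {..<m} \<union> {yt} \<union> {ys, z3}))) 3"
  using finite_subset[OF assms finite_lessThan] assms
proof (induction J rule: finite_induct)
  case empty
  have "vd_rank (G \<restriction> (b ` {..<m} \<union> {yt} \<union> {ys, z3})) (Suc (card {ys, z3}))"
    by (rule vd_rank_clique_isolated) (auto intro: graph_P_graph)
  then show ?case
    by (simp add: numeral_3_eq_3)
next
  case (insert j J)
  let ?W = "\<lambda>J. a ` J \<union> (b ` {..<m} \<union> {yt} \<union> {ys, z3})"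
  have 1: "?W (insert j J) - {a j} = ?W J"
    using insert by auto
  have 2: "?W (insert j J) - insert (a j) {v. a j \<rightarrow>\<^bsub>G\<^esub> v} = {b j, yt} \<union> {z3}"
    using insert by auto
  have "vd_rank (G \<restriction> ({b j, yt} \<union> {z3})) (Suc (card {z3}))"
    by (rule vd_rank_clique_isolated) (use insert in \<open>auto intro: graph_P_graph\<close>)
  then show ?case
    using insert vd_rank_induce_shedding[OF graph_P_graph, of "?W (insert j J)" "a j" m 2]
    unfolding 1 2 by (simp add: numeral_3_eq_3 numeral_2_eq_2)
qed

lemma vd_rank_del_nbhd_zs: "vd_rank (G \<restriction> (verts G - insert zs {v. zs \<rightarrow>\<^bsub>G\<^esub> v})) 2"
proof -
  have "verts G - insert zs {v. zs \<rightarrow>\<^bsub>G\<^esub> v} = a ` {..<m} \<union> {yt} \<union> b ` {..<m}"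
    unfolding verts_G by auto
  then show ?thesis
    using vd_rank_spider by simp
qed

lemma vd_rank_del_zs: "vd_rank (G \<restriction> (verts G - {zs})) 3"
proof -
  have 1: "verts G - {zs} - {zt} = a ` {..<m} \<union> (b ` {..<m} \<union> {yt} \<union> {ys, z3})"
    unfolding verts_G by auto
  \<comment> \<open>This is the graph of \<open>vd_rank_spider\<close> with the two sides exchanged,
    hence the use of \<open>swap\<close> below.\<close>
  have 2: "verts G - {zs} - insert zt {v. zt \<rightarrow>\<^bsub>G\<^esub> v} = b ` {..<m} \<union> {ys} \<union> a ` {..<m}"
    unfolding verts_G by auto
  show ?thesis
    using vd_rank_induce_shedding[OF graph_P_graph, of "verts G - {zs}" zt m 2]
      vd_rank_no_zs_zt[of "{..<m}"] P_sides.vd_rank_spider[OF swap, of "{..<m}"]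
    unfolding 1 2 by simp
qed

lemma vd_rank_G: "vd_rank G 3"
  using vd_rank_induce_shedding[OF graph_P_graph, of "verts G" zs m 2] vd_rank_del_zs vd_rank_del_nbhd_zs
  by (simp add: induce_subgraph_self[OF wf_digraph_axioms])

lemma zs_in_Shed: "zs \<in> Shed G"
  using vd_rank_del_zs vd_rank_del_nbhd_zs del_vertex_induce[of G "verts G" zs]
    del_closed_nbhd_induce[of zs "verts G" G]
  by (simp add: Shed_def vd_rank_def induce_subgraph_self[OF wf_digraph_axioms])

section \<open>The alternating sum after deleting \<open>ys\<close>\<close>

text \<open>Removing the \<open>b j\<close> in turn, every term has an isolated vertex:
  \<open>a j\<close> alone in the link, and \<open>yt\<close> in the final graph.\<close>

lemma alt_indep_sum_spider:
  assumes "J \<subseteq> {..<m}"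
  shows "alt_indep_sum (G \<restriction> (a ` {..<m} \<union> {yt} \<union> b ` J)) = 0"
  using finite_subset[OF assms finite_lessThan] assms
proof (induction J rule: finite_induct)
  case empty
  show ?case
    by (rule alt_indep_sum_induce_isolated[OF graph_P_graph, of _ yt]) auto
next
  case (insert j J)
  have 1: "a ` {..<m} \<union> {yt} \<union> b ` insert j J - {b j} = a ` {..<m} \<union> {yt} \<union> b ` J"
    using insert by auto
  have 2: "a ` {..<m} \<union> {yt} \<union> b ` insert j J - insert (b j) {v. b j \<rightarrow>\<^bsub>G\<^esub> v} = {a j}"
    using insert by auto
  have "alt_indep_sum (G \<restriction> {a j}) = 0"
    by (rule alt_indep_sum_induce_isolated[OF graph_P_graph, of _ "a j"]) (use insert in auto)
  then show ?case
    using insert alt_indep_sum_induce_rec[OF graph_P_graph, of "a ` {..<m} \<union> {yt} \<union> b ` insert j J" "b j" m]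
    unfolding 1 2 by simp
qed

text \<open>The link of each \<open>b j\<close> is the single vertex \<open>a j\<close> and
  contributes 0, so the value is that of the clique of all \<open>a i\<close>.\<close>

lemma alt_indep_sum_X:
  assumes "J \<subseteq> {..<m}"
  shows "alt_indep_sum (G \<restriction> (a ` {..<m} \<union> b ` J)) = 1 - int m"
  using finite_subset[OF assms finite_lessThan] assms
proof (induction J rule: finite_induct)
  case empty
  have "alt_indep_sum (G \<restriction> (a ` {..<m})) = 1 - int (card (a ` {..<m}))"
    by (rule alt_indep_sum_clique[OF graph_P_graph]) auto
  then show ?case
    by (simp add: card_image inj_on_def)
next
  case (insert j J)
  have 1: "a ` {..<m} \<union> b ` insert j J - {b j} = a ` {..<m} \<union> b ` J"
    using insert by auto
  have 2: "a ` {..<m} \<union> b ` insert j J - insert (b j) {v. b j \<rightarrow>\<^bsub>G\<^esub> v} = {a j}"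
    using insert by auto
  have "alt_indep_sum (G \<restriction> {a j}) = 0"
    by (rule alt_indep_sum_induce_isolated[OF graph_P_graph, of _ "a j"]) (use insert in auto)
  then show ?case
    using insert alt_indep_sum_induce_rec[OF graph_P_graph, of "a ` {..<m} \<union> b ` insert j J" "b j" m]
    unfolding 1 2 by simp
qed

text \<open>Branching on \<open>zt\<close>, the link is the graph on \<open>X\<close>, with sum
  \<open>1 - int m\<close>. The deletion contributes 0: branching once more on \<open>zs\<close>
  leaves \<open>z3\<close> isolated or gives the graph of
  \<open>alt_indep_sum_spider\<close>.\<close>

lemma alt_indep_sum_del_ys: "alt_indep_sum (G \<restriction> (verts G - {ys})) = int m - 1"
proof -
  let ?W = "a ` {..<m} \<union> b ` {..<m} \<union> {yt, zs, z3}"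
  have 1: "verts G - {ys} - {zt} = ?W"
    unfolding verts_G by auto
  have 2: "verts G - {ys} - insert zt {v. zt \<rightarrow>\<^bsub>G\<^esub> v} = a ` {..<m} \<union> b ` {..<m}"
    unfolding verts_G by auto
  have 3: "?W - insert zs {v. zs \<rightarrow>\<^bsub>G\<^esub> v} = a ` {..<m} \<union> {yt} \<union> b ` {..<m}"
    by auto
  have "alt_indep_sum (G \<restriction> (?W - {zs})) = 0"
    by (rule alt_indep_sum_induce_isolated[OF graph_P_graph, of _ z3]) auto
  then have "alt_indep_sum (G \<restriction> ?W) = 0"
    using alt_indep_sum_induce_rec[OF graph_P_graph, of ?W zs m] alt_indep_sum_spider[of "{..<m}"]
    unfolding 3 by simp
  then show ?thesis
    using alt_indep_sum_induce_rec[OF graph_P_graph, of "verts G - {ys}" zt m] alt_indep_sum_X[of "{..<m}"]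
    unfolding 1 2 by simp
qed

section \<open>Vertices that cannot be shed\<close>

lemma not_vertex_decomposable_del_ys: "\<not> vertex_decomposable (G \<restriction> (verts G - {ys}))"
proof
  assume vd: "vertex_decomposable (G \<restriction> (verts G - {ys}))"
  \<comment> \<open>A maximal set of odd size 3 fixes the sign: the sum \<open>int m - 1\<close>
    would have to be at most 0.\<close>
  have "maximal_independent_set (G \<restriction> (verts G - {ys})) {a 0, b 0, zs}"
    by (rule maximal_independent_setI)
      (use m in \<open>auto simp: independent_set_induce adj_induce_subgraph verts_G\<close>)
  from vertex_decomposable_alt_indep_sum[OF vd _ this] show False
    using m by (simp add: graph_induce_subgraph graph_P_graph alt_indep_sum_del_ys)
qed

text \<open>In \<open>G\<close> the set \<open>{ys, yt}\<close> dominates every other vertex except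
  \<open>z3\<close>. Without \<open>z3\<close> it is maximal of size 2, next to a maximal set of
  size 3.\<close>

lemma not_vertex_decomposable_del_z3: "\<not> vertex_decomposable (G \<restriction> (verts G - {z3}))"
proof
  let ?H = "G \<restriction> (verts G - {z3})"
  assume "vertex_decomposable ?H"
  then have "well_covered ?H"
    by (rule vertex_decomposable_well_covered)
  moreover have "maximal_independent_set ?H {a 0, b 0, zs}"
    by (rule maximal_independent_setI)
      (use m in \<open>auto simp: independent_set_induce adj_induce_subgraph verts_G\<close>)
  moreover have "maximal_independent_set ?H {ys, yt}"
    by (rule maximal_independent_setI)
      (auto simp: independent_set_induce adj_induce_subgraph verts_G)
  ultimately have "card {a 0, b 0, zs} = card {ys, yt}"
    unfolding well_covered_def by blast
  then show False
    by simp
qed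

text \<open>In \<open>G\<close> only \<open>a i\<close> can be added to \<open>{b i, zs}\<close>, so
  its deletion makes this pair maximal. A matched pair with another index \<open>j\<close>, which
  exists as \<open>m \<ge> 2\<close>, still gives a maximal set of size 3.\<close>

lemma not_vertex_decomposable_del_a:
  assumes "i < m"
  shows "\<not> vertex_decomposable (G \<restriction> (verts G - {a i}))"
proof
  let ?H = "G \<restriction> (verts G - {a i})"
  obtain j where j: "j < m" "j \<noteq> i"
    using m by (metis less_le_trans pos2 one_less_numeral_iff semiring_norm(76) zero_neq_one)
  assume "vertex_decomposable ?H"
  then have "well_covered ?H"
    by (rule vertex_decomposable_well_covered)
  moreover have "maximal_independent_set ?H {a j, b j, zs}"
    by (rule maximal_independent_setI)
      (use j in \<open>auto simp: independent_set_induce adj_induce_subgraph verts_G\<close>)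
  moreover have "maximal_independent_set ?H {b i, zs}"
    by (rule maximal_independent_setI)
      (use assms in \<open>auto simp: independent_set_induce adj_induce_subgraph verts_G\<close>)
  ultimately have "card {a j, b j, zs} = card {b i, zs}"
    unfolding well_covered_def by blast
  then show False
    by simp
qed

end

theorem theorem6p10:
  fixes m :: nat
  assumes "m \<ge> 2"
  shows "vertex_decomposable (P_graph m) \<and>
    (\<forall>v\<in>verts (P_graph m). v \<in> Shed (P_graph m) \<longleftrightarrow> v = z_vert 1 \<or> v = z_vert 2)"
proof -
  interpret A: P_sides m 1 2
    using assms by unfold_locales auto
  interpret B: P_sides m 2 1
    by (rule A.swap)
  have "v \<notin> Shed (P_graph m)"
    if v: "v \<in> verts (P_graph m)" "v \<noteq> z_vert 1" "v \<noteq> z_vert 2" for v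
  proof -
    \<comment> \<open>All other vertices fail the first condition of \<open>Shed\<close> already.
      The two interpretations cover both \<open>y_vert\<close> vertices and both halves of
      \<open>X\<close>.\<close>
    have "\<not> vertex_decomposable (P_graph m \<restriction> (verts (P_graph m) - {v}))"
      using v A.not_vertex_decomposable_del_ys B.not_vertex_decomposable_del_ys
        A.not_vertex_decomposable_del_z3
        A.not_vertex_decomposable_del_a B.not_vertex_decomposable_del_a
      unfolding A.verts_G by blast
    then show ?thesis
      by (simp add: Shed_def del_vertex_conv_induce A.wf_digraph_axioms)
  qed
  then show ?thesis
    using A.vd_rank_G A.zs_in_Shed B.zs_in_Shed by (auto simp: vd_rank_def)
qed

end
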